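(* Let $m \ge 1$ and $n \ge 2$ be integers, and let $R(x,y) = R_{C(2m,-2n)}(x,y)$ be the Riley polynomial of $C(2m,-2n)$, i.e. $R(x,y) = S_{n}(t) - z\,S_{n-1}(t)$ with $$t = 2 + (y+2-x)(y-2)S_{m-1}^2(y), \qquad z = 1 + (y+2-x)S_{m-1}(y)\,(S_m(y)-S_{m-1}(y)).$$ Then there exist $n-1$ continuous real functions $x_j \colon (2,\infty) \to (0,\infty)$, $1 \le j \le n-1$, in the variable $y$ such that $R(x_j(y),y)=0$ and $$y+2+\frac{4\sin^2\frac{(2j-1)\pi}{4n+2}}{(y-2)S_{m-1}^2(y)} < x_j(y) < y+2+\frac{4\sin^2\frac{(2j+1)\pi}{4n+2}}{(y-2)S_{m-1}^2(y)}$$ for all $y>2$.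
   Context: The Chebyshev polynomials $S_j(v)$, $j \in \mathbb{Z}$, are defined by $S_0(v)=1$, $S_1(v)=v$ and $S_j(v) = vS_{j-1}(v)-S_{j-2}(v)$ for all integers $j$ (so $S_{-1}=0$ and $S_{j}(v) = -S_{-j-2}(v)$). $C(2m,-2n)$ is a two-bridge knot in Conway notation; the zero locus of its Riley polynomial, with $x$ the square of the trace of a meridian, describes the nonabelian $\mathrm{SL}_2(\mathbb{C})$-representations of its knot group. Only the explicit formula for $R(x,y)$ is needed for the statement. *)

theory Defs
  imports "HOL-Analysis.Analysis"
begin

(* cheb_shift k = S_{k-1}; the shift makes the sequence start at S_{-1} = 0, the centre of the
   symmetry S_j = - S_{-j-2} by which the recurrence extends to negative indices. *)
fun cheb_shift :: "nat \<Rightarrow> 'a::comm_ring_1 \<Rightarrow> 'a" where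
  "cheb_shift 0 v = 0"
| "cheb_shift (Suc 0) v = 1"
| "cheb_shift (Suc (Suc k)) v = v * cheb_shift (Suc k) v - cheb_shift k v"

definition cheb_S :: "int \<Rightarrow> 'a::comm_ring_1 \<Rightarrow> 'a" where
  "cheb_S j v =
     (if j \<ge> -1 then cheb_shift (nat (j + 1)) v else - cheb_shift (nat (- j - 1)) v)"

lemma cheb_S_0: "cheb_S 0 v = 1"
  by (simp add: cheb_S_def)

lemma cheb_S_1: "cheb_S 1 v = v"
  by (simp add: cheb_S_def numeral_2_eq_2)

lemma cheb_S_rec: "cheb_S j v = v * cheb_S (j - 1) v - cheb_S (j - 2) v"
proof -
  consider "j \<ge> 1" | "j = 0" | "j \<le> -1" by linarith
  then show ?thesis
  proof cases
    case 1
    define k where "k = nat (j - 1)"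
    have "nat (j + 1) = Suc (Suc k)" "nat j = Suc k" "nat (j - 1) = k"
      using 1 by (auto simp: k_def)
    then show ?thesis using 1 by (simp add: cheb_S_def)
  next
    case 2
    then show ?thesis by (simp add: cheb_S_def)
  next
    case 3
    define k where "k = nat (- j - 1)"
    have "nat (- j - 1) = k" "nat (- j) = Suc k" "nat (1 - j) = Suc (Suc k)"
      using 3 by (auto simp: k_def)
    moreover have "j = -1 \<Longrightarrow> k = 0" by (simp add: k_def)
    ultimately show ?thesis using 3 by (auto simp: cheb_S_def)
  qed
qed

definition riley_t :: "int \<Rightarrow> 'a::comm_ring_1 \<Rightarrow> 'a \<Rightarrow> 'a" where
  "riley_t m x y = 2 + (y + 2 - x) * (y - 2) * (cheb_S (m - 1) y)\<^sup>2"

definition riley_z :: "int \<Rightarrow> 'a::comm_ring_1 \<Rightarrow> 'a \<Rightarrow> 'a" where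
  "riley_z m x y =
     1 + (y + 2 - x) * cheb_S (m - 1) y * (cheb_S m y - cheb_S (m - 1) y)"

(* Riley polynomial of C(2m,-2n), as an evaluation map. *)
definition riley :: "int \<Rightarrow> int \<Rightarrow> 'a::comm_ring_1 \<Rightarrow> 'a \<Rightarrow> 'a" where
  "riley m n x y =
     cheb_S n (riley_t m x y) - riley_z m x y * cheb_S (n - 1) (riley_t m x y)"

end

theory Submission
  imports Defs
begin

text \<open>
  Put \<open>a = S\<^bsub>m-1\<^esub>(y)\<close>, \<open>b = S\<^bsub>m\<^esub>(y) - S\<^bsub>m-1\<^esub>(y)\<close> and parametrise \<open>x\<close> by an angle \<open>\<phi>\<close> through
  \<open>x = y + 2 + 4 sin\<^sup>2 \<phi> / ((y - 2) a\<^sup>2)\<close>. Then \<open>t = 2 cos 2\<phi>\<close> and \<open>z = 1 - 4 c sin\<^sup>2 \<phi>\<close> with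
  \<open>c = b / ((y - 2) a)\<close>, so that \<open>y\<close> enters the equation \<open>R = 0\<close> only through \<open>c\<close>. Since
  \<open>S\<^bsub>k-1\<^esub>(2 cos \<theta>) sin \<theta> = sin k\<theta>\<close>, sum-to-product formulas turn \<open>R = 0\<close> into
  \<open>cos ((2n-1)\<phi>) = r cos ((2n+1)\<phi>)\<close> with \<open>r = 1 - 1/c\<close> (\<open>riley_eq_0\<close>).

  The interval prescribed for \<open>x\<^sub>j\<close> corresponds to the range of \<open>\<phi>\<close> between two consecutive zeros
  of \<open>cos ((2n+1)\<phi>)\<close>. There the quotient \<open>cos ((2n-1)\<phi>) / cos ((2n+1)\<phi>)\<close> increases strictly
  (\<open>cos_quotient_less\<close>) and takes every real value (\<open>cos_quotient_surj\<close>), so its inverse is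
  a continuous function \<open>\<phi> = g r\<close> on the whole real line (\<open>cos_quotient_inverse\<close>).
  For \<open>y > 2\<close> both \<open>a\<close> and \<open>b\<close> are positive; hence \<open>r\<close> is continuous in \<open>y\<close>, and so is the
  root obtained from \<open>g r\<close>.
\<close>

section \<open>Chebyshev polynomials\<close>

lemma cheb_shift_cos:
  fixes \<theta> :: real
  shows "cheb_shift k (2 * cos \<theta>) * sin \<theta> = sin (real k * \<theta>)"
proof (induction k rule: induct_nat_012)
  case (ge2 k)
  have "sin (real (Suc (Suc k)) * \<theta>) + sin (real k * \<theta>) = 2 * cos \<theta> * sin (real (Suc k) * \<theta>)"
    using sin_add[of "real (Suc k) * \<theta>" \<theta>] sin_diff[of "real (Suc k) * \<theta>" \<theta>]
    by (simp add: algebra_simps)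
  with ge2 show ?case by (simp add: algebra_simps)
qed auto

text \<open>For \<open>v \<ge> 2\<close> the recurrence makes the successive differences nondecreasing:
  \<open>S\<^bsub>k+1\<^esub> - S\<^bsub>k\<^esub> = (S\<^bsub>k\<^esub> - S\<^bsub>k-1\<^esub>) + (v - 2) S\<^bsub>k\<^esub>\<close>.\<close>

lemma cheb_shift_increasing:
  fixes v :: real
  assumes "v \<ge> 2"
  shows "0 \<le> cheb_shift k v \<and> cheb_shift k v < cheb_shift (Suc k) v"
proof (induction k)
  case (Suc k)
  then have "2 * cheb_shift (Suc k) v \<le> v * cheb_shift (Suc k) v"
    using assms by (intro mult_right_mono) auto
  moreover have "cheb_shift (Suc (Suc k)) v = v * cheb_shift (Suc k) v - cheb_shift k v" by simp
  ultimately show ?case using Suc by linarith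
qed auto

lemma continuous_on_cheb_shift: "continuous_on A (cheb_shift k :: real \<Rightarrow> real)"
  by (induction k rule: induct_nat_012) (auto intro!: continuous_intros)

lemma continuous_on_cheb_S: "continuous_on A (cheb_S k :: real \<Rightarrow> real)"
  unfolding cheb_S_def
  by (cases "k \<ge> -1") (auto intro!: continuous_intros continuous_on_cheb_shift)

lemma cheb_S_pos_increasing:
  fixes y :: real
  assumes "m \<ge> 1" "y > 2"
  shows "0 < cheb_S (m - 1) y" "cheb_S (m - 1) y < cheb_S m y"
proof -
  obtain k where k: "nat m = Suc k" using assms by (cases "nat m") auto
  then have "cheb_S (m - 1) y = cheb_shift (Suc k) y"
    "cheb_S m y = cheb_shift (Suc (Suc k)) y"
    using assms by (auto simp: cheb_S_def nat_add_distrib)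
  then show "0 < cheb_S (m - 1) y" "cheb_S (m - 1) y < cheb_S m y"
    using cheb_shift_increasing[of y k] cheb_shift_increasing[of y "Suc k"] assms by auto
qed

section \<open>The equation in terms of the angle\<close>

text \<open>With \<open>a\<close>, \<open>b\<close>, \<open>c\<close> as above, multiplying \<open>R\<close> by \<open>sin 2\<phi> \<noteq> 0\<close> gives
  \<open>2 sin \<phi> (c cos ((2n-1)\<phi>) - (c - 1) cos ((2n+1)\<phi>))\<close>.
  The assumption \<open>eq\<close> makes this vanish, because \<open>c - 1 = c r\<close> for \<open>r = 1 - (y - 2) a / b\<close>.\<close>

lemma riley_eq_0:
  fixes y \<phi> :: real
  assumes mn: "m \<ge> 1" "y > 2" and \<phi>: "0 < \<phi>" "\<phi> < pi / 2"
    and eq: "cos ((2 * real n - 1) * \<phi>) =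
       (1 - (y - 2) * cheb_S (m - 1) y / (cheb_S m y - cheb_S (m - 1) y))
         * cos ((2 * real n + 1) * \<phi>)"
  shows "riley m (int n) (y + 2 + 4 * (sin \<phi>)\<^sup>2 / ((y - 2) * (cheb_S (m - 1) y)\<^sup>2)) y = 0"
proof -
  define a where "a = cheb_S (m - 1) y"
  define b where "b = cheb_S m y - cheb_S (m - 1) y"
  define c where "c = b / ((y - 2) * a)"
  define x where "x = y + 2 + 4 * (sin \<phi>)\<^sup>2 / ((y - 2) * a\<^sup>2)"
  have ab: "a > 0" "b > 0" using cheb_S_pos_increasing[OF mn] by (auto simp: a_def b_def)
  have "riley_t m x y = 2 - 4 * (sin \<phi>)\<^sup>2"
    using ab mn by (simp add: riley_t_def x_def flip: a_def)
  then have t: "riley_t m x y = 2 * cos (2 * \<phi>)"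
    by (simp add: cos_double_sin)
  have "riley_z m x y = 1 + (y + 2 - x) * a * b"
    by (simp add: riley_z_def a_def b_def)
  also have "\<dots> = 1 - 4 * c * (sin \<phi>)\<^sup>2"
    using ab mn by (simp add: x_def c_def power2_eq_square)
  finally have z: "riley_z m x y = 1 - 4 * c * (sin \<phi>)\<^sup>2" .
  have "c * cos ((2 * real n - 1) * \<phi>) = (c - 1) * cos ((2 * real n + 1) * \<phi>)"
  proof -
    have "c * (1 - (y - 2) * a / b) = c - 1"
      using ab mn by (simp add: c_def field_simps)
    moreover have "cos ((2 * real n - 1) * \<phi>) = (1 - (y - 2) * a / b) * cos ((2 * real n + 1) * \<phi>)"
      using eq by (simp only: a_def b_def)
    ultimately show ?thesis by (metis mult.assoc)
  qed
  moreover have "cos ((2 * real n - 1) * \<phi>) - cos ((2 * real n + 1) * \<phi>)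
      = 2 * sin \<phi> * sin (2 * real n * \<phi>)"
    using cos_diff_cos[of "(2 * real n - 1) * \<phi>" "(2 * real n + 1) * \<phi>"]
    by (simp add: field_simps)
  ultimately have key: "cos ((2 * real n + 1) * \<phi>) + 2 * c * sin \<phi> * sin (2 * real n * \<phi>) = 0"
    by algebra
  have diff: "sin (real (Suc n) * (2 * \<phi>)) - sin (2 * real n * \<phi>)
      = 2 * sin \<phi> * cos ((2 * real n + 1) * \<phi>)"
    using sin_add[of "(2 * real n + 1) * \<phi>" \<phi>] sin_diff[of "(2 * real n + 1) * \<phi>" \<phi>]
    by (simp add: algebra_simps)
  have "riley m (int n) x y
      = cheb_shift (Suc n) (2 * cos (2 * \<phi>))
        - (1 - 4 * c * (sin \<phi>)\<^sup>2) * cheb_shift n (2 * cos (2 * \<phi>))"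
    by (simp add: riley_def t z cheb_S_def nat_add_distrib)
  then have "riley m (int n) x y * sin (2 * \<phi>)
      = cheb_shift (Suc n) (2 * cos (2 * \<phi>)) * sin (2 * \<phi>)
        - (1 - 4 * c * (sin \<phi>)\<^sup>2) * (cheb_shift n (2 * cos (2 * \<phi>)) * sin (2 * \<phi>))"
    by (simp only: left_diff_distrib mult.assoc)
  also have "\<dots> = sin (real (Suc n) * (2 * \<phi>)) - (1 - 4 * c * (sin \<phi>)\<^sup>2) * sin (2 * real n * \<phi>)"
    by (simp only: cheb_shift_cos) (simp add: mult_ac)
  also have "\<dots> = 2 * sin \<phi>
      * (cos ((2 * real n + 1) * \<phi>) + 2 * c * sin \<phi> * sin (2 * real n * \<phi>))"
    using diff by algebra
  finally have "riley m (int n) x y * sin (2 * \<phi>) = 0" using key by simp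
  moreover have "sin (2 * \<phi>) > 0" using \<phi> by (intro sin_gt_zero) auto
  ultimately show ?thesis by (simp add: x_def a_def)
qed

section \<open>The quotient of cosines between two zeros of its denominator\<close>

lemma abs_sin_mult_less:
  fixes \<alpha> :: real
  assumes "0 < \<alpha>" "\<alpha> < pi" "k \<ge> 2"
  shows "\<bar>sin (real k * \<alpha>)\<bar> < real k * sin \<alpha>"
  using assms(3)
proof (induction k rule: dec_induct)
  case base
  have s: "sin \<alpha> > 0" using assms sin_gt_zero by blast
  have "\<bar>cos \<alpha>\<bar> < 1"
    unfolding abs_square_less_1[symmetric]
    using sin_cos_squared_add[of \<alpha>] zero_less_power[OF s, of 2] by linarith
  then have "sin \<alpha> * \<bar>cos \<alpha>\<bar> < sin \<alpha> * 1" using s by (intro mult_strict_left_mono)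
  then show ?case using s by (simp add: sin_double abs_mult)
next
  case (step k)
  have s: "sin \<alpha> > 0" using assms sin_gt_zero by blast
  have "sin (real (Suc k) * \<alpha>) = sin (real k * \<alpha>) * cos \<alpha> + cos (real k * \<alpha>) * sin \<alpha>"
    by (simp add: distrib_right sin_add algebra_simps)
  also have "\<bar>\<dots>\<bar> \<le> \<bar>sin (real k * \<alpha>)\<bar> * \<bar>cos \<alpha>\<bar> + \<bar>cos (real k * \<alpha>)\<bar> * \<bar>sin \<alpha>\<bar>"
    by (metis abs_mult abs_triangle_ineq)
  also have "\<dots> \<le> \<bar>sin (real k * \<alpha>)\<bar> * 1 + 1 * \<bar>sin \<alpha>\<bar>"
    by (intro add_mono mult_left_mono mult_right_mono) auto
  finally show ?case using step s by (simp add: algebra_simps)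
qed

context
  fixes n j :: nat and p q :: real
  assumes j: "1 \<le> j" "j < n"
  defines "p \<equiv> (2 * real j - 1) * pi / (4 * real n + 2)"
    and "q \<equiv> (2 * real j + 1) * pi / (4 * real n + 2)"
begin

lemma angle_bounds: "0 < p" "p < q" "q < pi / 2"
proof -
  have n: "4 * real n + 2 > 0" by simp
  show "0 < p" using j by (simp add: p_def)
  show "p < q" unfolding p_def q_def using n by (intro divide_strict_right_mono) auto
  have "(2 * real j + 1) * pi < (2 * real n + 1) * pi"
    using j by (intro mult_strict_right_mono) auto
  then show "q < pi / 2" unfolding q_def using n by (simp add: pos_divide_less_eq field_simps)
qed

lemma angle_endpoints:
  "(2 * real n + 1) * p = real j * pi - pi / 2" "(2 * real n + 1) * q = real j * pi + pi / 2"
proof -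
  have "4 * real n + 2 = 2 * (2 * real n + 1)" "2 * real n + 1 \<noteq> 0" by auto
  then show "(2 * real n + 1) * p = real j * pi - pi / 2"
    "(2 * real n + 1) * q = real j * pi + pi / 2"
    unfolding p_def q_def by (simp_all only: times_divide_eq_right) (simp_all add: field_simps)
qed

lemma cos_denominator_nonzero:
  assumes "\<phi> \<in> {p<..<q}"
  shows "cos ((2 * real n + 1) * \<phi>) \<noteq> 0"
proof -
  define \<psi> where "\<psi> = (2 * real n + 1) * \<phi> - real j * pi"
  have "(2 * real n + 1) * p < (2 * real n + 1) * \<phi>" "(2 * real n + 1) * \<phi> < (2 * real n + 1) * q"
    using assms by (auto intro!: mult_strict_left_mono)
  then have "\<bar>\<psi>\<bar> < pi / 2" unfolding \<psi>_def angle_endpoints by linarith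
  then have "cos \<psi> > 0" by (intro cos_gt_zero_pi) auto
  moreover have "cos ((2 * real n + 1) * \<phi>) = cos (real j * pi + \<psi>)" by (simp add: \<psi>_def)
  ultimately show ?thesis by (simp add: cos_add)
qed

text \<open>The numerator of the derivative is
  \<open>(2n+1) cos ((2n-1)\<phi>) sin ((2n+1)\<phi>) - (2n-1) sin ((2n-1)\<phi>) cos ((2n+1)\<phi>)
    = 2n sin 2\<phi> + sin (2n 2\<phi>)\<close>, which is positive by \<open>abs_sin_mult_less\<close>.\<close>

lemma cos_quotient_less:
  assumes "u \<in> {p<..<q}" "v \<in> {p<..<q}" "u < v"
  shows "cos ((2 * real n - 1) * u) / cos ((2 * real n + 1) * u)
       < cos ((2 * real n - 1) * v) / cos ((2 * real n + 1) * v)"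
proof (rule DERIV_pos_imp_increasing[OF \<open>u < v\<close>])
  fix \<phi> assume "u \<le> \<phi>" "\<phi> \<le> v"
  then have \<phi>: "\<phi> \<in> {p<..<q}" using assms by auto
  define A where "A = (2 * real n - 1) * \<phi>"
  define B where "B = (2 * real n + 1) * \<phi>"
  have B0: "cos B \<noteq> 0" unfolding B_def by (rule cos_denominator_nonzero[OF \<phi>])
  have "((\<lambda>\<phi>. cos ((2 * real n - 1) * \<phi>) / cos ((2 * real n + 1) * \<phi>)) has_real_derivative
      ((2 * real n + 1) * cos A * sin B - (2 * real n - 1) * sin A * cos B) / (cos B)\<^sup>2) (at \<phi>)"
    using B0 unfolding A_def B_def
    by (auto intro!: derivative_eq_intros simp: power2_eq_square field_simps)
  moreover have "(2 * real n + 1) * cos A * sin B - (2 * real n - 1) * sin A * cos B > 0"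
  proof -
    have "B - A = 2 * \<phi>" "B + A = real (2 * n) * (2 * \<phi>)"
      by (auto simp: A_def B_def algebra_simps)
    then have sums: "sin (2 * \<phi>) = sin B * cos A - cos B * sin A"
      "sin (real (2 * n) * (2 * \<phi>)) = sin B * cos A + cos B * sin A"
      by (metis sin_diff, metis sin_add)
    have "(2 * real n + 1) * cos A * sin B - (2 * real n - 1) * sin A * cos B
        = real (2 * n) * sin (2 * \<phi>) + sin (real (2 * n) * (2 * \<phi>))"
      unfolding sums by (simp add: algebra_simps)
    moreover have "\<bar>sin (real (2 * n) * (2 * \<phi>))\<bar> < real (2 * n) * sin (2 * \<phi>)"
      using \<phi> angle_bounds j by (intro abs_sin_mult_less) auto
    ultimately show ?thesis by linarith
  qed
  ultimately show "\<exists>d. ((\<lambda>\<phi>. cos ((2 * real n - 1) * \<phi>) / cos ((2 * real n + 1) * \<phi>))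
      has_real_derivative d) (at \<phi>) \<and> 0 < d"
    using B0 by (intro exI conjI) (assumption, simp)
qed

text \<open>At the endpoints \<open>cos ((2n+1)\<phi>) = 0\<close> and \<open>sin ((2n+1)\<phi>) = \<plusminus>1\<close>, with opposite signs; since
  \<open>(2n-1)\<phi> = (2n+1)\<phi> - 2\<phi>\<close>, the difference \<open>cos ((2n-1)\<phi>) - r cos ((2n+1)\<phi>)\<close> equals \<open>\<plusminus>sin 2\<phi>\<close>
  there and changes sign, whatever \<open>r\<close> is.\<close>

lemma cos_quotient_surj:
  "\<exists>\<phi>\<in>{p<..<q}. cos ((2 * real n - 1) * \<phi>) / cos ((2 * real n + 1) * \<phi>) = r"
proof -
  define F where
    "F \<phi> = (-1) ^ j * (cos ((2 * real n - 1) * \<phi>) - r * cos ((2 * real n + 1) * \<phi>))" for \<phi> :: real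
  have split: "cos ((2 * real n - 1) * \<phi>)
      = cos ((2 * real n + 1) * \<phi>) * cos (2 * \<phi>) + sin ((2 * real n + 1) * \<phi>) * sin (2 * \<phi>)"
    for \<phi> :: real
    using cos_diff[of "(2 * real n + 1) * \<phi>" "2 * \<phi>"] by (simp add: algebra_simps)
  have sq: "(-1) ^ j * (-1) ^ j = (1::real)" by (simp flip: power_add)
  have "F p = - sin (2 * p)"
    unfolding F_def split angle_endpoints using sq by (simp add: cos_diff sin_diff)
  also have "\<dots> < 0" using angle_bounds by (auto intro!: sin_gt_zero)
  finally have Fp: "F p < 0" .
  have "F q = sin (2 * q)"
    unfolding F_def split angle_endpoints using sq by (simp add: cos_add sin_add)
  also have "\<dots> > 0" using angle_bounds by (auto intro!: sin_gt_zero)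
  finally have Fq: "F q > 0" .
  have "continuous_on {p..q} F" unfolding F_def by (intro continuous_intros)
  then obtain \<phi> where \<phi>: "p \<le> \<phi>" "\<phi> \<le> q" "F \<phi> = 0"
    using IVT'[of F p 0 q] Fp Fq angle_bounds by auto
  then have "\<phi> \<noteq> p" "\<phi> \<noteq> q" using Fp Fq by auto
  with \<phi> have in_pq: "\<phi> \<in> {p<..<q}" by auto
  have "cos ((2 * real n - 1) * \<phi>) = r * cos ((2 * real n + 1) * \<phi>)"
    using \<phi>(3) by (simp add: F_def)
  with in_pq cos_denominator_nonzero[OF in_pq] show ?thesis by (intro bexI[of _ \<phi>]) auto
qed

lemma cos_quotient_inverse:
  obtains g :: "real \<Rightarrow> real" where "continuous_on UNIV g" "\<And>r. p < g r" "\<And>r. g r < q"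
    "\<And>r. cos ((2 * real n - 1) * g r) = r * cos ((2 * real n + 1) * g r)"
proof -
  define h where "h \<phi> = cos ((2 * real n - 1) * \<phi>) / cos ((2 * real n + 1) * \<phi>)" for \<phi> :: real
  have h_less: "h u < h v" if "u \<in> {p<..<q}" "v \<in> {p<..<q}" "u < v" for u v
    unfolding h_def using that by (rule cos_quotient_less)
  obtain g where g: "\<And>r. g r \<in> {p<..<q}" "\<And>r. h (g r) = r"
    using cos_quotient_surj unfolding h_def by metis
  have mono: "g r \<le> g s" if "r \<le> s" for r s
    using h_less[OF g(1)[of s] g(1)[of r]] that by (force simp: g(2) not_le[symmetric])
  have gh: "g (h \<phi>) = \<phi>" if "\<phi> \<in> {p<..<q}" for \<phi>
    using h_less[OF g(1) that, of "h \<phi>"] h_less[OF that g(1), of "h \<phi>"]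
    by (force simp: g(2))
  have "range g = {p<..<q}"
  proof
    show "{p<..<q} \<subseteq> range g" using gh by (metis rangeI subsetI)
  qed (use g(1) in auto)
  \<comment> \<open>A monotone function with open range has no jumps.\<close>
  then have "continuous_on UNIV g"
    by (intro continuous_onI_mono) (auto intro: mono)
  moreover have "cos ((2 * real n - 1) * g r) = r * cos ((2 * real n + 1) * g r)" for r
    using g(2)[of r] cos_denominator_nonzero[OF g(1)[of r]] by (simp add: h_def field_simps)
  ultimately show ?thesis using g(1) that by auto
qed

end

section \<open>The roots\<close>

lemma riley_root_branch:
  fixes m :: int and n j :: nat
  assumes m: "m \<ge> 1" and j: "1 \<le> j" "j < n"
  shows "\<exists>f :: real \<Rightarrow> real. continuous_on {2<..} f \<and> f ` {2<..} \<subseteq> {0<..} \<and>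
           (\<forall>y>2.
              riley m (int n) (f y) y = 0 \<and>
              y + 2 + 4 * (sin ((2 * real j - 1) * pi / (4 * real n + 2)))\<^sup>2
                        / ((y - 2) * (cheb_S (m - 1) y)\<^sup>2) < f y \<and>
              f y < y + 2 + 4 * (sin ((2 * real j + 1) * pi / (4 * real n + 2)))\<^sup>2
                        / ((y - 2) * (cheb_S (m - 1) y)\<^sup>2))"
proof -
  define p where "p = (2 * real j - 1) * pi / (4 * real n + 2)"
  define q where "q = (2 * real j + 1) * pi / (4 * real n + 2)"
  obtain g where g: "continuous_on UNIV g" "\<And>r. p < g r" "\<And>r. g r < q"
    "\<And>r. cos ((2 * real n - 1) * g r) = r * cos ((2 * real n + 1) * g r)"
    unfolding p_def q_def using cos_quotient_inverse[OF j] by metis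
  have pq: "0 < p" "p < q" "q < pi / 2"
    unfolding p_def q_def using angle_bounds[OF j] by auto
  define r where
    "r y = 1 - (y - 2) * cheb_S (m - 1) y / (cheb_S m y - cheb_S (m - 1) y)" for y :: real
  define d where "d y = (y - 2) * (cheb_S (m - 1) y)\<^sup>2" for y :: real
  define f where "f y = y + 2 + 4 * (sin (g (r y)))\<^sup>2 / d y" for y :: real
  have d: "d y > 0" if "y > 2" for y
    using cheb_S_pos_increasing(1)[OF m that] that by (simp add: d_def)
  have "continuous_on {2<..} r"
    unfolding r_def using cheb_S_pos_increasing(2)[OF m]
    by (intro continuous_intros continuous_on_cheb_S) force
  then have "continuous_on {2<..} (\<lambda>y. g (r y))"
    using continuous_on_compose2[OF g(1)] by auto
  moreover have "continuous_on {2<..} d"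
    unfolding d_def by (intro continuous_intros continuous_on_cheb_S)
  ultimately have cont: "continuous_on {2<..} f"
    unfolding f_def using d by (intro continuous_intros) force+
  have root: "riley m (int n) (f y) y = 0" if "y > 2" for y
    unfolding f_def d_def using pq g(2,3)[of "r y"]
    by (intro riley_eq_0[OF m that _ _ g(4)[of "r y", unfolded r_def], folded r_def]) auto
  have sin2_less: "(sin u)\<^sup>2 < (sin v)\<^sup>2" if "0 < u" "u < v" "v < pi / 2" for u v :: real
    using that sin_gt_zero[of u] sin_monotone_2pi[of u v] by (intro power_strict_mono) auto
  have lower: "y + 2 + 4 * (sin p)\<^sup>2 / d y < f y" if "y > 2" for y
    using sin2_less[of p "g (r y)"] g(2,3)[of "r y"] pq d[OF that]
    by (simp add: f_def divide_strict_right_mono)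
  have upper: "f y < y + 2 + 4 * (sin q)\<^sup>2 / d y" if "y > 2" for y
    using sin2_less[of "g (r y)" q] g(2,3)[of "r y"] pq d[OF that]
    by (simp add: f_def divide_strict_right_mono)
  have "f y > 0" if "y > 2" for y
    using that d[OF that] by (auto simp: f_def intro!: add_pos_nonneg)
  then show ?thesis
    using cont root lower upper unfolding p_def q_def d_def by (intro exI[of _ f]) auto
qed

theorem proposition4p2:
  fixes m n :: int
  assumes "m \<ge> 1" and "n \<ge> 2"
  shows "\<exists>x :: int \<Rightarrow> real \<Rightarrow> real. \<forall>j\<in>{1..n-1}.
           continuous_on {2<..} (x j) \<and>
           x j ` {2<..} \<subseteq> {0<..} \<and>
           (\<forall>y>2.
              riley m n (x j y) y = 0 \<and>
              y + 2 + 4 * (sin ((2 * real_of_int j - 1) * pi / (4 * real_of_int n + 2)))\<^sup>2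
                        / ((y - 2) * (cheb_S (m - 1) y)\<^sup>2) < x j y \<and>
              x j y < y + 2 + 4 * (sin ((2 * real_of_int j + 1) * pi / (4 * real_of_int n + 2)))\<^sup>2
                        / ((y - 2) * (cheb_S (m - 1) y)\<^sup>2))"
proof (rule bchoice, rule ballI)
  fix j assume j: "j \<in> {1..n-1}"
  then have "1 \<le> nat j" "nat j < nat n" "int (nat n) = n"
    "real (nat n) = real_of_int n" "real (nat j) = real_of_int j"
    by auto
  then show "\<exists>f. continuous_on {2<..} f \<and> f ` {2<..} \<subseteq> {0<..} \<and>
           (\<forall>y>2.
              riley m n (f y) y = 0 \<and>
              y + 2 + 4 * (sin ((2 * real_of_int j - 1) * pi / (4 * real_of_int n + 2)))\<^sup>2
                        / ((y - 2) * (cheb_S (m - 1) y)\<^sup>2) < f y \<and>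
              f y < y + 2 + 4 * (sin ((2 * real_of_int j + 1) * pi / (4 * real_of_int n + 2)))\<^sup>2
                        / ((y - 2) * (cheb_S (m - 1) y)\<^sup>2))"
    using riley_root_branch[OF \<open>m \<ge> 1\<close>, of "nat j" "nat n"] by simp
qed

end
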